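(* Suppose that $p_0(t;w)\ge P(t)$, $\frac{q_0(t;w)}{p_0(t;w)}\ge Q(t)$ and $r_0(t;w)\ge0$ for all $t\ge t_0$, $w\in(-\infty;+\infty)$. Then for all $\phi_{(0)},\phi_{(1)}\in\mathbb{R}$, every solution $\phi_0(t)$ of $$(p_0(t;\phi(t))\phi'(t))'+q_0(t;\phi(t))\phi'(t)+r_0(t;\phi(t))\phi(t)=0,\qquad t\ge t_0,$$ satisfying $\phi_0(t_0)=\phi_{(0)}$, $\phi_0'(t_0)=\phi_{(1)}$, which is not extendable to $[t_0;+\infty)$ (that is, whose maximum existence interval is $[t_0;T)$ with $T<+\infty$) is singular oscillatory of second kind.
   Context: Fix $t_0\in\mathbb{R}$. The functions $p_0(t;w),q_0(t;w),r_0(t;w)$ are real valued and continuous on $[t_0;+\infty)\times(-\infty;+\infty)$, with $p_0(t;w)>0$ everywhere. The functions $P(t),Q(t)$ are real valued and continuous on $[t_0;+\infty)$, with $P(t)>0$. A solution on an interval is a continuously differentiable function $\phi$ such that $p_0(t;\phi(t))\phi'(t)$ is continuously differentiable and the equation holds. The set $[t_0;T)$ is the maximum existence interval of a solution $\phi_0$ if $\phi_0$ exists on $[t_0;T)$ and cannot be continued to the right of $T$ as a solution of the equation. A solution $\phi_0(t)$ is called singular oscillatory of second kind if the existence domain of $\phi_0$ is a bounded set and $\phi_0$ changes sign infinitely many times. *)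

theory Defs
  imports "HOL-Analysis.Analysis"
begin

(* Coefficients are total functions; only their values at times in I matter.  Derivatives are
   taken relative to I, hence one-sided at an endpoint of I that belongs to I. *)
definition solution_on ::
  "(real \<Rightarrow> real \<Rightarrow> real) \<Rightarrow> (real \<Rightarrow> real \<Rightarrow> real) \<Rightarrow> (real \<Rightarrow> real \<Rightarrow> real) \<Rightarrow>
   real set \<Rightarrow> (real \<Rightarrow> real) \<Rightarrow> bool" where
  "solution_on p q r I \<phi> \<longleftrightarrow>
     (\<exists>\<phi>' \<psi>'.
        (\<forall>t\<in>I. (\<phi> has_real_derivative \<phi>' t) (at t within I)) \<and> continuous_on I \<phi>' \<and>
        (\<forall>t\<in>I. ((\<lambda>s. p s (\<phi> s) * \<phi>' s) has_real_derivative \<psi>' t) (at t within I)) \<and>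
        continuous_on I \<psi>' \<and>
        (\<forall>t\<in>I. \<psi>' t + q t (\<phi> t) * \<phi>' t + r t (\<phi> t) * \<phi> t = 0))"

definition maximal_existence_interval ::
  "(real \<Rightarrow> real \<Rightarrow> real) \<Rightarrow> (real \<Rightarrow> real \<Rightarrow> real) \<Rightarrow> (real \<Rightarrow> real \<Rightarrow> real) \<Rightarrow>
   real \<Rightarrow> real \<Rightarrow> (real \<Rightarrow> real) \<Rightarrow> bool" where
  "maximal_existence_interval p q r t0 T \<phi> \<longleftrightarrow>
     t0 < T \<and> solution_on p q r {t0..<T} \<phi> \<and>
     \<not> (\<exists>T' \<psi>. T < T' \<and> solution_on p q r {t0..<T'} \<psi> \<and> (\<forall>t\<in>{t0..<T}. \<psi> t = \<phi> t))"

(* The number of sign changes is the supremum of the lengths of finite chains of consecutive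
   points with alternating strict signs; touching zero without crossing does not count. *)
definition changes_sign_infinitely_often_on :: "real set \<Rightarrow> (real \<Rightarrow> real) \<Rightarrow> bool" where
  "changes_sign_infinitely_often_on D \<phi> \<longleftrightarrow>
     (\<forall>n::nat. \<exists>s::nat \<Rightarrow> real. strict_mono_on {..n} s \<and> s ` {..n} \<subseteq> D \<and>
        (\<forall>i<n. \<phi> (s i) * \<phi> (s (Suc i)) < 0))"

(* D is the existence domain of \<phi>. *)
definition singular_oscillatory_second_kind :: "real set \<Rightarrow> (real \<Rightarrow> real) \<Rightarrow> bool" where
  "singular_oscillatory_second_kind D \<phi> \<longleftrightarrow> bounded D \<and> changes_sign_infinitely_often_on D \<phi>"

end

theory Submission
  imports Defs "HOL-Complex_Analysis.Great_Picard"
begin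

text \<open>
  If \<open>\<phi>\<close> changed sign only finitely often, it would have constant sign near \<open>T\<close>, say \<open>\<phi> \<ge> 0\<close>. With
  \<open>u = p \<phi>'\<close> the equation reads \<open>u' = - (q/p) u - r \<phi>\<close>, so \<open>u exp (\<integral> q/p)\<close> is nonincreasing. Since
  \<open>q/p \<ge> Q\<close> and \<open>p \<ge> P\<close>, this bounds \<open>\<phi>'\<close> from above near \<open>T\<close>, and \<open>\<phi>\<close>, being bounded below, has
  a finite limit at \<open>T\<close>. The coefficients along \<open>\<phi>\<close> then extend continuously to \<open>T\<close>, and so does \<open>u\<close>,
  which solves a linear equation with these coefficients. Peano's theorem for the system in \<open>(\<phi>, u)\<close>
  started at \<open>T\<close> continues the solution past \<open>T\<close>, a contradiction. Peano's theorem itself follows by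
  Tonelli's method: equations with delay \<open>h\<close> are solved explicitly, and Arzela--Ascoli gives a limit
  as \<open>h\<close> tends to \<open>0\<close>.
\<close>

section \<open>Peano's existence theorem\<close>

lemma continuous_on_along_graph:
  assumes "continuous_on D (\<lambda>(t, x). g t x)" "continuous_on I z" "\<And>s. s \<in> I \<Longrightarrow> (s, z s) \<in> D"
  shows "continuous_on I (\<lambda>s. g s (z s))"
proof -
  have "continuous_on I (\<lambda>s. (\<lambda>(t, x). g t x) (s, z s))"
    using assms by (intro continuous_on_compose2[OF assms(1)] continuous_intros) auto
  then show ?thesis by simp
qed

text \<open>At time \<open>t\<close> the right-hand side involves \<open>y\<close> only up to
  \<open>max a (t - h)\<close>, so the equation determines \<open>y\<close> successively on steps of
  length \<open>h\<close>. The clamp at \<open>a\<close> supplies the constant history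
  \<open>y a = x0\<close>.\<close>

lemma delayed_solution_exists:
  fixes g :: "real \<Rightarrow> 'a::euclidean_space \<Rightarrow> 'a"
  assumes g: "continuous_on ({a..b} \<times> UNIV) (\<lambda>(t, x). g t x)" and h: "h > 0"
  obtains y where "continuous_on {a..b} y"
    "\<And>t. t \<in> {a..b} \<Longrightarrow> y t = x0 + integral {a..t} (\<lambda>s. g s (y (max a (s - h))))"
proof -
  define F where "F y t = x0 + integral {a..t} (\<lambda>s. g s (y (max a (s - h))))" for y t
  define Y where "Y k = (F ^^ k) (\<lambda>_. x0)" for k
  have Y_Suc: "Y (Suc k) = F (Y k)" for k
    by (simp add: Y_def)
  have Y_a: "Y k a = x0" for k
    by (cases k) (simp_all add: Y_def F_def)
  have cont: "continuous_on {a..b} (Y k)" for k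
  proof (induction k)
    case 0
    show ?case by (simp add: Y_def)
  next
    case (Suc k)
    have "continuous_on {a..b} (\<lambda>s. Y k (max a (s - h)))"
      using h by (intro continuous_on_compose2[OF Suc] continuous_intros) auto
    then have "continuous_on {a..b} (\<lambda>s. g s (Y k (max a (s - h))))"
      by (intro continuous_on_along_graph[OF g]) auto
    then show ?case
      unfolding Y_Suc F_def
      by (intro continuous_intros indefinite_integral_continuous_1 integrable_continuous_real) simp
  qed
  text \<open>Because of the delay, finitely many iterations reach the fixed point on \<open>{a..b}\<close>.\<close>
  have stable: "Y (Suc k) t = Y k t" if "t \<in> {a..a + k * h}" for k t
    using that
  proof (induction k arbitrary: t)
    case 0
    then show ?case using Y_a by auto
  next
    case (Suc k)
    \<comment> \<open>For \<open>s \<le> a + Suc k * h\<close> the delayed argument is at most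
      \<open>a + k * h\<close>, where the induction hypothesis applies.\<close>
    have "Y (Suc k) (max a (s - h)) = Y k (max a (s - h))" if "s \<in> {a..t}" for s
      using that Suc.prems h by (intro Suc.IH) (auto simp: algebra_simps)
    then have "integral {a..t} (\<lambda>s. g s (Y (Suc k) (max a (s - h))))
             = integral {a..t} (\<lambda>s. g s (Y k (max a (s - h))))"
      by (intro integral_cong) simp
    then show ?case
      by (simp add: Y_Suc[of "Suc k"] Y_Suc[of k] F_def)
  qed
  obtain k :: nat where "(b - a) / h \<le> k"
    using real_arch_simple by blast
  then have k: "b \<le> a + k * h"
    using h by (simp add: field_simps)
  have "Y k t = F (Y k) t" if "t \<in> {a..b}" for t
    using stable[of t k] that k by (simp add: Y_Suc)
  then show thesis
    using that[of "Y k"] cont by (simp add: F_def)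
qed

text \<open>The solutions with delay \<open>h n\<close> share the initial value \<open>x0\<close>
  and the Lipschitz constant \<open>M\<close>, so Arzela-Ascoli yields a uniformly convergent
  subsequence. The integral form of the equation survives the limit by dominated
  convergence.\<close>

lemma peano_bounded:
  fixes g :: "real \<Rightarrow> 'a::euclidean_space \<Rightarrow> 'a"
  assumes g: "continuous_on ({a..b} \<times> UNIV) (\<lambda>(t, x). g t x)"
    and M: "\<And>t x. t \<in> {a..b} \<Longrightarrow> norm (g t x) \<le> M"
  obtains y where "continuous_on {a..b} y"
    "\<And>t. t \<in> {a..b} \<Longrightarrow> y t = x0 + integral {a..t} (\<lambda>s. g s (y s))"
proof (cases "a \<le> b")
  case ab: True
  define h where "h n = 1 / real (Suc n)" for n
  have h: "h n > 0" for n
    by (simp add: h_def)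
  have h0: "h \<longlonglongrightarrow> 0"
    unfolding h_def by (rule LIMSEQ_Suc) (rule lim_1_over_n)
  have "\<exists>y. continuous_on {a..b} y \<and> (\<forall>t\<in>{a..b}. y t = x0 + integral {a..t} (\<lambda>s. g s (y (max a (s - h n)))))" for n
    using delayed_solution_exists[OF g h[of n], of x0] by metis
  then obtain Y where Yc: "\<And>n. continuous_on {a..b} (Y n)"
    and Y: "\<And>n t. t \<in> {a..b} \<Longrightarrow> Y n t = x0 + integral {a..t} (\<lambda>s. g s (Y n (max a (s - h n))))"
    by metis
  have M0: "M \<ge> 0"
    using order_trans[OF norm_ge_zero M[of a 0]] ab by simp
  have gc: "continuous_on {a..b} (\<lambda>s. g s (z s))" if "continuous_on {a..b} z" for z
    using that by (intro continuous_on_along_graph[OF g]) auto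
  have Ygc: "continuous_on {a..b} (\<lambda>s. g s (Y n (max a (s - h n))))" for n
    using h[of n] by (intro gc continuous_on_compose2[OF Yc] continuous_intros) (auto simp: less_imp_le)
  \<comment> \<open>This bound is independent of \<open>n\<close>. It gives uniform boundedness and
    equicontinuity, and later controls the error caused by the delay.\<close>
  have lip: "norm (Y n t - Y n s) \<le> M * \<bar>t - s\<bar>" if "s \<in> {a..b}" "t \<in> {a..b}" for n s t
    using that
  proof (induction s t rule: linorder_wlog)
    case (le s t)
    have "integral {a..s} (\<lambda>s. g s (Y n (max a (s - h n)))) + integral {s..t} (\<lambda>s. g s (Y n (max a (s - h n))))
        = integral {a..t} (\<lambda>s. g s (Y n (max a (s - h n))))"
      using le by (intro Henstock_Kurzweil_Integration.integral_combine integrable_continuous_real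
          continuous_on_subset[OF Ygc]) auto
    then have "Y n t - Y n s = integral {s..t} (\<lambda>s. g s (Y n (max a (s - h n))))"
      using le Y[of t n] Y[of s n] by (simp add: algebra_simps)
    also have "norm \<dots> \<le> M * (t - s)"
      using le M by (intro integral_bound continuous_on_subset[OF Ygc]) auto
    finally show ?case using le by simp
  qed (simp add: norm_minus_commute abs_minus_commute)
  have Ya: "Y n a = x0" for n
    using Y[of a n] ab by simp
  have bdd: "norm (Y n t) \<le> norm x0 + M * (b - a)" if "t \<in> {a..b}" for n t
  proof -
    have "norm (Y n t) \<le> norm x0 + norm (Y n t - Y n a)"
      using norm_triangle_ineq[of x0 "Y n t - Y n a"] by (simp add: Ya)
    also have "norm (Y n t - Y n a) \<le> M * \<bar>t - a\<bar>"
      using that by (intro lip) auto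
    also have "\<dots> \<le> M * (b - a)"
      using that M0 by (intro mult_left_mono) auto
    finally show ?thesis by simp
  qed
  have equi: "\<exists>d>0. \<forall>n s. s \<in> {a..b} \<and> norm (t - s) < d \<longrightarrow> norm (Y n t - Y n s) < e"
    if "t \<in> {a..b}" "e > 0" for t e
  proof (intro exI conjI allI impI)
    \<comment> \<open>The denominator is \<open>M + 1\<close> because \<open>M\<close> may be
      0.\<close>
    show "e / (M + 1) > 0" using that M0 by simp
    fix n s assume s: "s \<in> {a..b} \<and> norm (t - s) < e / (M + 1)"
    have "norm (Y n t - Y n s) \<le> M * \<bar>t - s\<bar>"
      using s that by (intro lip) auto
    also have "\<dots> \<le> (M + 1) * \<bar>t - s\<bar>"
      by (simp add: algebra_simps)
    also have "\<dots> < e"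
      using s M0 by (simp add: field_simps)
    finally show "norm (Y n t - Y n s) < e" .
  qed
  obtain y k where yc: "continuous_on {a..b} y" and k: "strict_mono (k :: nat \<Rightarrow> nat)"
    and unif: "\<And>e. 0 < e \<Longrightarrow> \<exists>N. \<forall>n x. n \<ge> N \<and> x \<in> {a..b} \<longrightarrow> norm (Y (k n) x - y x) < e"
    using Arzela_Ascoli[of "{a..b}" Y, OF _ bdd equi] by auto
  have lim: "(\<lambda>n. Y (k n) t) \<longlonglongrightarrow> y t" if "t \<in> {a..b}" for t
    unfolding LIMSEQ_iff using unif that by meson
  have hk: "(\<lambda>n. h (k n)) \<longlonglongrightarrow> 0"
    using LIMSEQ_subseq_LIMSEQ[OF h0 k] by (simp add: o_def)
  \<comment> \<open>The delayed argument is within \<open>h (k n)\<close> of \<open>t\<close>, so by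
    \<open>lip\<close> the delay changes the value by at most \<open>M * h (k n)\<close>.\<close>
  have lim_delayed: "(\<lambda>n. Y (k n) (max a (t - h (k n)))) \<longlonglongrightarrow> y t" if "t \<in> {a..b}" for t
  proof -
    have "(\<lambda>n. Y (k n) (max a (t - h (k n))) - Y (k n) t) \<longlonglongrightarrow> 0"
    proof (rule Lim_null_comparison)
      have "norm (Y (k n) (max a (t - h (k n))) - Y (k n) t) \<le> M * h (k n)" for n
      proof -
        have "norm (Y (k n) (max a (t - h (k n))) - Y (k n) t) \<le> M * \<bar>max a (t - h (k n)) - t\<bar>"
          using that h[of "k n"] by (intro lip) auto
        also have "\<dots> \<le> M * h (k n)"
          using that h[of "k n"] M0 by (intro mult_left_mono) auto
        finally show ?thesis .
      qed
      then show "\<forall>\<^sub>F n in sequentially. norm (Y (k n) (max a (t - h (k n))) - Y (k n) t) \<le> M * h (k n)"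
        by simp
      show "(\<lambda>n. M * h (k n)) \<longlonglongrightarrow> 0"
        using tendsto_mult_right_zero[OF hk] .
    qed
    from tendsto_add[OF this lim[OF that]] show ?thesis by simp
  qed
  have "y t = x0 + integral {a..t} (\<lambda>s. g s (y s))" if t: "t \<in> {a..b}" for t
  proof (rule LIMSEQ_unique[OF lim[OF t]])
    have "(\<lambda>n. integral {a..t} (\<lambda>s. g s (Y (k n) (max a (s - h (k n))))))
        \<longlonglongrightarrow> integral {a..t} (\<lambda>s. g s (y s))"
    proof (rule dominated_convergence(2)[where h = "\<lambda>_. M"])
      show "(\<lambda>s. g s (Y (k n) (max a (s - h (k n))))) integrable_on {a..t}" for n
        using t by (intro integrable_continuous_real continuous_on_subset[OF Ygc]) auto
      show "(\<lambda>n. g s (Y (k n) (max a (s - h (k n))))) \<longlonglongrightarrow> g s (y s)" if "s \<in> {a..t}" for s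
      proof -
        have s: "s \<in> {a..b}" using that t by auto
        have "continuous_on UNIV (g s)"
          using continuous_on_compose2[OF g, of UNIV "Pair s"] s
          by (simp add: continuous_on_Pair image_subset_iff)
        then show ?thesis
          by (rule continuous_on_tendsto_compose[OF _ lim_delayed[OF s]]) auto
      qed
    qed (use M t in auto)
    then show "(\<lambda>n. Y (k n) t) \<longlonglongrightarrow> x0 + integral {a..t} (\<lambda>s. g s (y s))"
      unfolding Y[OF t] by (intro tendsto_intros)
  qed
  then show thesis
    using that yc by blast
\<comment> \<open>If \<open>b < a\<close>, the interval is empty and both claims are
  vacuous.\<close>
qed (use that in auto)

text \<open>Composing with the nearest-point projection onto the ball turns \<open>f\<close> into a
  bounded field on the whole space. Its solution stays in the ball for a while, and there the
  projection is the identity.\<close>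

theorem peano:
  fixes f :: "real \<Rightarrow> 'a::euclidean_space \<Rightarrow> 'a"
  assumes f: "continuous_on ({a..b} \<times> cball x0 r) (\<lambda>(t, x). f t x)" and "a < b" "r > 0"
  obtains c x where "a < c" "c \<le> b" "x a = x0"
    "\<And>t. t \<in> {a..c} \<Longrightarrow> (x has_vector_derivative f t (x t)) (at t within {a..c})"
proof -
  define g where "g t x = f t (closest_point (cball x0 r) x)" for t x
  have cp: "closest_point (cball x0 r) x \<in> cball x0 r" for x
    using \<open>r > 0\<close> by (intro closest_point_in_set) auto
  have "continuous_on ({a..b} \<times> UNIV) (\<lambda>z. (\<lambda>(t, x). f t x) (fst z, closest_point (cball x0 r) (snd z)))"
    using \<open>r > 0\<close> cp
    by (intro continuous_on_compose2[OF f] continuous_intros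
        continuous_on_compose2[OF continuous_on_closest_point[of "cball x0 r" UNIV]]) (auto simp del: mem_cball)
  then have gc: "continuous_on ({a..b} \<times> UNIV) (\<lambda>(t, x). g t x)"
    by (simp add: g_def split_beta)
  have "compact ((\<lambda>(t, x). f t x) ` ({a..b} \<times> cball x0 r))"
    by (intro compact_continuous_image f compact_Times) auto
  then obtain M where M: "M > 0" "\<And>y. y \<in> (\<lambda>(t, x). f t x) ` ({a..b} \<times> cball x0 r) \<Longrightarrow> norm y \<le> M"
    by (meson bounded_pos compact_imp_bounded)
  have gM: "norm (g t x) \<le> M" if "t \<in> {a..b}" for t x
    unfolding g_def using that cp by (intro M(2)) (auto simp del: mem_cball)
  obtain x where xc: "continuous_on {a..b} x"
    and x: "\<And>t. t \<in> {a..b} \<Longrightarrow> x t = x0 + integral {a..t} (\<lambda>s. g s (x s))"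
    using peano_bounded[OF gc gM] by blast
  have gxc: "continuous_on {a..b} (\<lambda>s. g s (x s))"
    using xc by (intro continuous_on_along_graph[OF gc]) auto
  \<comment> \<open>At speed at most \<open>M\<close>, covering the distance \<open>r\<close> takes
    at least time \<open>r / M\<close>.\<close>
  define c where "c = min b (a + r / M)"
  have c: "a < c" "c \<le> b" "M * (c - a) \<le> r"
    using \<open>a < b\<close> \<open>r > 0\<close> \<open>M > 0\<close> by (auto simp: c_def min_def field_simps)
  have near: "x t \<in> cball x0 r" if "t \<in> {a..c}" for t
  proof -
    have "norm (integral {a..t} (\<lambda>s. g s (x s))) \<le> M * (t - a)"
      using that c gM by (intro integral_bound continuous_on_subset[OF gxc]) auto
    also have "\<dots> \<le> M * (c - a)"
      using that M(1) by (intro mult_left_mono) auto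
    finally show ?thesis
      using x[of t] that c by (simp add: dist_norm)
  qed
  have "(x has_vector_derivative f t (x t)) (at t within {a..c})" if t: "t \<in> {a..c}" for t
  proof (rule has_vector_derivative_transform[OF t])
    have "((\<lambda>u. integral {a..u} (\<lambda>s. g s (x s))) has_vector_derivative g t (x t)) (at t within {a..c})"
      using c t by (intro integral_has_vector_derivative continuous_on_subset[OF gxc]) auto
    then show "((\<lambda>u. x0 + integral {a..u} (\<lambda>s. g s (x s))) has_vector_derivative f t (x t)) (at t within {a..c})"
      using near[OF t] by (auto intro!: derivative_eq_intros simp: g_def closest_point_self simp del: mem_cball)
    show "x s = x0 + integral {a..s} (\<lambda>s. g s (x s))" if "s \<in> {a..c}" for s
      using that c by (intro x) auto
  qed
  moreover have "x a = x0"
    using x[of a] \<open>a < b\<close> by simp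
  ultimately show thesis
    using that c by blast
qed

section \<open>Behaviour of solutions at the endpoint\<close>

text \<open>The fundamental theorem of calculus tolerates finitely many exceptional points, so
  \<open>x\<close> is the integral of \<open>v\<close> up to a constant, and continuity of
  \<open>v\<close> gives the derivative at those points too. This serves to glue two solutions at
  \<open>T\<close>.\<close>

lemma has_vector_derivative_except_finite:
  fixes x :: "real \<Rightarrow> 'a::banach"
  assumes x: "continuous_on {a..b} x" and v: "continuous_on {a..b} v" and "finite S"
    and deriv: "\<And>t. t \<in> {a<..<b} - S \<Longrightarrow> (x has_vector_derivative v t) (at t)"
    and t: "t \<in> {a..b}"
  shows "(x has_vector_derivative v t) (at t within {a..b})"
proof (rule has_vector_derivative_transform[OF t])
  show "((\<lambda>s. x a + integral {a..s} v) has_vector_derivative v t) (at t within {a..b})"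
    using integral_has_vector_derivative[OF v t] by (auto intro!: derivative_eq_intros)
  fix s assume s: "s \<in> {a..b}"
  have "(v has_integral x s - x a) {a..s}"
    using s by (intro fundamental_theorem_of_calculus_interior_strong[OF \<open>finite S\<close>] deriv
        continuous_on_subset[OF x]) auto
  then show "x s = x a + integral {a..s} v"
    by (simp add: integral_unique)
qed

lemma antimono_bounded_tendsto_at_left:
  fixes f :: "real \<Rightarrow> real"
  assumes "a < b" and anti: "\<And>s t. a \<le> s \<Longrightarrow> s \<le> t \<Longrightarrow> t < b \<Longrightarrow> f t \<le> f s"
    and bound: "\<And>t. t \<in> {a..<b} \<Longrightarrow> c \<le> f t"
  shows "(f \<longlongrightarrow> (INF t\<in>{a..<b}. f t)) (at_left b)"
proof (rule decreasing_tendsto)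
  have ev: "\<forall>\<^sub>F t in at_left b. t \<in> {s<..<b}" if "s < b" for s
    using that eventually_at_left_field by auto
  have bdd: "bdd_below (f ` {a..<b})"
    using bound by (intro bdd_belowI[of _ c]) auto
  show "\<forall>\<^sub>F t in at_left b. (INF t\<in>{a..<b}. f t) \<le> f t"
    using ev[OF \<open>a < b\<close>] by eventually_elim (auto intro!: cINF_lower bdd)
  fix y assume "(INF t\<in>{a..<b}. f t) < y"
  then obtain s where "s \<in> {a..<b}" "f s < y"
    using \<open>a < b\<close> by (subst (asm) cINF_less_iff) (auto intro: bdd)
  then show "\<forall>\<^sub>F t in at_left b. f t < y"
    using ev[of s] by (auto elim!: eventually_mono intro: le_less_trans[OF anti])
qed

text \<open>The integrating factor \<open>exp G\<close> bounds \<open>u\<close> from above, hence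
  also the slope of \<open>\<phi>\<close>, say by \<open>K\<close>. Then
  \<open>\<phi> t - K * t\<close> is nonincreasing and bounded below, so it converges.\<close>

lemma nonneg_solution_has_limit:
  fixes \<phi> u p h r :: "real \<Rightarrow> real"
  assumes "a < T"
    and \<phi>: "\<And>t. t \<in> {a..<T} \<Longrightarrow> (\<phi> has_real_derivative u t / p t) (at t within {a..<T})"
    and u: "\<And>t. t \<in> {a..<T} \<Longrightarrow>
          (u has_real_derivative - (h t * u t) - r t * \<phi> t) (at t within {a..<T})"
    and h: "continuous_on {a..<T} h"
    and "m > 0" and p: "\<And>t. t \<in> {a..<T} \<Longrightarrow> m \<le> p t"
    and "B \<ge> 0" and hB: "\<And>t. t \<in> {a..<T} \<Longrightarrow> - B \<le> h t"
    and r: "\<And>t. t \<in> {a..<T} \<Longrightarrow> 0 \<le> r t"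
    and nonneg: "\<And>t. t \<in> {a..<T} \<Longrightarrow> 0 \<le> \<phi> t"
  obtains L where "(\<phi> \<longlongrightarrow> L) (at_left T)"
proof -
  define G where "G t = integral {a..t} h" for t
  \<comment> \<open>It will be shown that \<open>u t \<le> u a * exp (- G t)\<close>, and
    \<open>h \<ge> - B\<close> gives \<open>- G t \<le> B * (T - a)\<close>. The absolute value
    ensures \<open>C \<ge> 0\<close>.\<close>
  define C where "C = \<bar>u a\<bar> * exp (B * (T - a))"
  have at: "(at t within {a..<T}) = at t" if "a < t" "t < T" for t
    using that by (intro at_within_interior) simp
  have u_le: "u t \<le> C" if t: "t \<in> {a..<T}" for t
  proof -
    have hc: "continuous_on {a..t} h"
      using t by (intro continuous_on_subset[OF h]) auto
    have G: "(G has_real_derivative h s) (at s within {a..t})" if "s \<in> {a..t}" for s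
      unfolding has_real_derivative_iff_has_vector_derivative G_def
      using hc that by (rule integral_has_vector_derivative)
    have "u t * exp (G t) \<le> u a * exp (G a)"
    proof (rule DERIV_nonpos_imp_decreasing_open[where f = "\<lambda>s. u s * exp (G s)"])
      show "a \<le> t" using t by simp
      have "continuous_on {a..t} u"
        using t by (intro continuous_on_subset[OF DERIV_continuous_on[OF u]]) auto
      moreover have "continuous_on {a..t} G"
        using DERIV_continuous_on[OF G] .
      ultimately show "continuous_on {a..t} (\<lambda>s. u s * exp (G s))"
        by (intro continuous_intros)
      fix s assume s: "a < s" "s < t"
      \<comment> \<open>The terms with \<open>h s * u s\<close> cancel; the remaining one has a sign
        because \<open>r\<close> and \<open>\<phi>\<close> are nonnegative.\<close>
      have "((\<lambda>s. u s * exp (G s)) has_real_derivative - (r s * \<phi> s * exp (G s))) (at s)"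
      proof -
        have "(u has_real_derivative - (h s * u s) - r s * \<phi> s) (at s)"
          using u[of s] s t at[of s] by simp
        moreover have "(G has_real_derivative h s) (at s)"
          using G[of s] s at_within_Icc_at[of a s t] by simp
        ultimately show ?thesis
          by (auto intro!: derivative_eq_intros simp: algebra_simps)
      qed
      moreover have "r s * \<phi> s * exp (G s) \<ge> 0"
        using s t r nonneg by (intro mult_nonneg_nonneg) auto
      ultimately show "\<exists>y. ((\<lambda>s. u s * exp (G s)) has_real_derivative y) (at s) \<and> y \<le> 0"
        by (intro exI[of _ "- (r s * \<phi> s * exp (G s))"]) auto
    qed
    then have "u t \<le> u a * exp (- G t)"
      by (simp add: G_def exp_minus field_simps)
    also have "\<dots> \<le> \<bar>u a\<bar> * exp (B * (T - a))"
    proof -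
      have "integral {a..t} (\<lambda>_. - B) \<le> G t"
        unfolding G_def using t hB by (intro integral_le integrable_continuous_real hc) auto
      moreover have "B * (t - a) \<le> B * (T - a)"
        using t \<open>B \<ge> 0\<close> by (intro mult_left_mono) auto
      ultimately have "- G t \<le> B * (T - a)"
        using t by (simp add: algebra_simps)
      then show ?thesis
        by (intro mult_mono) auto
    qed
    finally show ?thesis by (simp add: C_def)
  qed
  define K where "K = C / m"
  have K: "K \<ge> 0"
    using \<open>m > 0\<close> by (simp add: K_def C_def)
  have slope: "u t / p t \<le> K" if t: "t \<in> {a..<T}" for t
  proof -
    \<comment> \<open>Since \<open>u t\<close> may be negative, it is replaced by the nonnegative
      \<open>C\<close> before the denominator is lowered to \<open>m\<close>.\<close>
    have "u t / p t \<le> C / p t"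
      using u_le[OF t] p[OF t] \<open>m > 0\<close> by (intro divide_right_mono) auto
    also have "\<dots> \<le> C / m"
      using p[OF t] \<open>m > 0\<close> by (intro divide_left_mono mult_pos_pos) (auto simp: C_def)
    finally show ?thesis by (simp add: K_def)
  qed
  have "\<phi> t - K * t \<le> \<phi> s - K * s" if st: "a \<le> s" "s \<le> t" "t < T" for s t
  proof (rule DERIV_nonpos_imp_decreasing_open[where f = "\<lambda>t. \<phi> t - K * t"])
    show "s \<le> t" by fact
    have "continuous_on {s..t} \<phi>"
      using st by (intro continuous_on_subset[OF DERIV_continuous_on[OF \<phi>]]) auto
    then show "continuous_on {s..t} (\<lambda>t. \<phi> t - K * t)"
      by (intro continuous_intros)
    fix x assume "s < x" "x < t"
    then show "\<exists>y. ((\<lambda>t. \<phi> t - K * t) has_real_derivative y) (at x) \<and> y \<le> 0"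
      using \<phi>[of x] slope[of x] st at[of x]
      by (intro exI[of _ "u x / p x - K"]) (auto intro!: derivative_eq_intros)
  qed
  moreover have "- (K * T) \<le> \<phi> t - K * t" if "t \<in> {a..<T}" for t
    using nonneg[OF that] mult_left_mono[of t T K] that K by auto
  ultimately have "((\<lambda>t. \<phi> t - K * t) \<longlongrightarrow> (INF t\<in>{a..<T}. \<phi> t - K * t)) (at_left T)"
    using \<open>a < T\<close> by (rule antimono_bounded_tendsto_at_left[rotated])
  then have "((\<lambda>t. (\<phi> t - K * t) + K * t) \<longlongrightarrow> (INF t\<in>{a..<T}. \<phi> t - K * t) + K * T) (at_left T)"
    by (intro tendsto_intros)
  then show thesis
    using that by simp
qed

text \<open>Variation of constants expresses \<open>u\<close> through integrals of \<open>h\<close>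
  and \<open>k\<close>, and this formula remains meaningful and continuous at
  \<open>b\<close>.\<close>

lemma linear_ode_extends_to_endpoint:
  fixes u h k :: "real \<Rightarrow> real"
  assumes h: "continuous_on {a..b} h" and k: "continuous_on {a..b} k"
    and u: "\<And>t. t \<in> {a..<b} \<Longrightarrow> (u has_real_derivative - (h t * u t) - k t) (at t within {a..<b})"
  obtains v where "continuous_on {a..b} v" "\<And>t. t \<in> {a..<b} \<Longrightarrow> v t = u t"
proof -
  define H where "H t = integral {a..t} h" for t
  define v where "v t = exp (- H t) * (u a - integral {a..t} (\<lambda>s. k s * exp (H s)))" for t
  have H: "(H has_real_derivative h s) (at s within {a..b})" if "s \<in> {a..b}" for s
    unfolding has_real_derivative_iff_has_vector_derivative H_def
    using h that by (rule integral_has_vector_derivative)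
  have Hc: "continuous_on {a..b} H"
    using DERIV_continuous_on[OF H] .
  have "continuous_on {a..b} v"
    unfolding v_def
    by (intro continuous_intros indefinite_integral_continuous_1 integrable_continuous_real k Hc)
  moreover have "v t = u t" if t: "t \<in> {a..<b}" for t
  proof -
    have "((\<lambda>s. - (k s * exp (H s))) has_integral u t * exp (H t) - u a * exp (H a)) {a..t}"
    proof (rule fundamental_theorem_of_calculus)
      show "a \<le> t" using t by simp
      fix s assume s: "s \<in> {a..t}"
      have "(u has_real_derivative - (h s * u s) - k s) (at s within {a..t})"
        using s t by (intro has_field_derivative_subset[OF u]) auto
      moreover have "(H has_real_derivative h s) (at s within {a..t})"
        using s t by (intro has_field_derivative_subset[OF H]) auto
      ultimately show "((\<lambda>s. u s * exp (H s)) has_vector_derivative - (k s * exp (H s))) (at s within {a..t})"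
        unfolding has_real_derivative_iff_has_vector_derivative[symmetric]
        by (auto intro!: derivative_eq_intros simp: algebra_simps)
    qed
    then have "- integral {a..t} (\<lambda>s. k s * exp (H s)) = u t * exp (H t) - u a"
      by (simp add: integral_unique H_def flip: integral_neg)
    then show ?thesis
      unfolding v_def by (simp add: exp_minus field_simps)
  qed
  ultimately show thesis
    using that by blast
qed

section \<open>The scalar equation as a first-order system in \<open>\<phi>\<close> and
  \<open>u\<close>\<close>

lemma solution_on_imp_system:
  assumes "solution_on p q r I \<phi>" and p: "\<And>t. t \<in> I \<Longrightarrow> p t (\<phi> t) > 0"
  obtains u where
    "\<And>t. t \<in> I \<Longrightarrow> (\<phi> has_real_derivative u t / p t (\<phi> t)) (at t within I)"
    "\<And>t. t \<in> I \<Longrightarrow>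
      (u has_real_derivative - (q t (\<phi> t) / p t (\<phi> t) * u t) - r t (\<phi> t) * \<phi> t) (at t within I)"
proof -
  obtain \<phi>' \<psi>' where \<phi>': "\<And>t. t \<in> I \<Longrightarrow> (\<phi> has_real_derivative \<phi>' t) (at t within I)"
    and \<psi>': "\<And>t. t \<in> I \<Longrightarrow> ((\<lambda>s. p s (\<phi> s) * \<phi>' s) has_real_derivative \<psi>' t) (at t within I)"
    and eq: "\<And>t. t \<in> I \<Longrightarrow> \<psi>' t + q t (\<phi> t) * \<phi>' t + r t (\<phi> t) * \<phi> t = 0"
    using assms(1) unfolding solution_on_def by blast
  show thesis
  \<comment> \<open>The witness for \<open>u\<close> is \<open>p * \<phi>'\<close>.\<close>
  proof (rule that)
    fix t assume t: "t \<in> I"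
    note pt = p[OF t]
    show "(\<phi> has_real_derivative (p t (\<phi> t) * \<phi>' t) / p t (\<phi> t)) (at t within I)"
      using \<phi>'[OF t] pt by simp
    have "\<psi>' t = - (q t (\<phi> t) / p t (\<phi> t) * (p t (\<phi> t) * \<phi>' t)) - r t (\<phi> t) * \<phi> t"
      using eq[OF t] pt by simp
    with \<psi>'[OF t] show "((\<lambda>s. p s (\<phi> s) * \<phi>' s) has_real_derivative
        - (q t (\<phi> t) / p t (\<phi> t) * (p t (\<phi> t) * \<phi>' t)) - r t (\<phi> t) * \<phi> t) (at t within I)"
      by simp
  qed
qed

text \<open>The continuity conditions in \<open>solution_on\<close> come from the system itself:
  \<open>\<phi>\<close> and \<open>u\<close> are differentiable, hence continuous, and both
  derivatives are continuous expressions in them and the coefficients.\<close>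

lemma system_imp_solution_on:
  assumes pc: "continuous_on I (\<lambda>t. p t (\<phi> t))" and qc: "continuous_on I (\<lambda>t. q t (\<phi> t))"
    and rc: "continuous_on I (\<lambda>t. r t (\<phi> t))"
    and p: "\<And>t. t \<in> I \<Longrightarrow> p t (\<phi> t) > 0"
    and \<phi>: "\<And>t. t \<in> I \<Longrightarrow> (\<phi> has_real_derivative u t / p t (\<phi> t)) (at t within I)"
    and u: "\<And>t. t \<in> I \<Longrightarrow>
      (u has_real_derivative - (q t (\<phi> t) / p t (\<phi> t) * u t) - r t (\<phi> t) * \<phi> t) (at t within I)"
  shows "solution_on p q r I \<phi>"
  unfolding solution_on_def
proof (intro exI conjI ballI)
  have p0: "\<forall>t\<in>I. p t (\<phi> t) \<noteq> 0"
    using p by force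
  have \<phi>c: "continuous_on I \<phi>"
    using \<phi> by (rule DERIV_continuous_on)
  have uc: "continuous_on I u"
    using u by (rule DERIV_continuous_on)
  show "continuous_on I (\<lambda>t. u t / p t (\<phi> t))"
    using p0 by (intro continuous_intros uc pc)
  show "continuous_on I (\<lambda>t. - (q t (\<phi> t) / p t (\<phi> t) * u t) - r t (\<phi> t) * \<phi> t)"
    using p0 by (intro continuous_intros uc pc qc rc \<phi>c)
  fix t assume t: "t \<in> I"
  show "(\<phi> has_real_derivative u t / p t (\<phi> t)) (at t within I)"
    using \<phi>[OF t] .
  show "((\<lambda>s. p s (\<phi> s) * (u s / p s (\<phi> s))) has_real_derivative
      - (q t (\<phi> t) / p t (\<phi> t) * u t) - r t (\<phi> t) * \<phi> t) (at t within I)"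
    using p0 by (intro has_field_derivative_transform_within[OF u[OF t] zero_less_one t]) auto
  show "- (q t (\<phi> t) / p t (\<phi> t) * u t) - r t (\<phi> t) * \<phi> t
      + q t (\<phi> t) * (u t / p t (\<phi> t)) + r t (\<phi> t) * \<phi> t = 0"
    by simp
qed

section \<open>Continuation of solutions\<close>

theorem solution_continues_past_limit:
  fixes p q r :: "real \<Rightarrow> real \<Rightarrow> real"
  assumes p: "continuous_on ({a..} \<times> UNIV) (\<lambda>(t, w). p t w)"
    and q: "continuous_on ({a..} \<times> UNIV) (\<lambda>(t, w). q t w)"
    and r: "continuous_on ({a..} \<times> UNIV) (\<lambda>(t, w). r t w)"
    and p_pos: "\<And>t w. a \<le> t \<Longrightarrow> p t w > 0"
    and "a < T" and sol: "solution_on p q r {a..<T} \<phi>"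
    and lim: "(\<phi> \<longlongrightarrow> L) (at_left T)"
  obtains T' \<psi> where "T < T'" "solution_on p q r {a..<T'} \<psi>" "\<And>t. t \<in> {a..<T} \<Longrightarrow> \<psi> t = \<phi> t"
proof -
  obtain u where
    \<phi>: "\<And>t. t \<in> {a..<T} \<Longrightarrow> (\<phi> has_real_derivative u t / p t (\<phi> t)) (at t within {a..<T})"
    and u: "\<And>t. t \<in> {a..<T} \<Longrightarrow> (u has_real_derivative
          - (q t (\<phi> t) / p t (\<phi> t) * u t) - r t (\<phi> t) * \<phi> t) (at t within {a..<T})"
    using solution_on_imp_system[OF sol] p_pos by (metis atLeastLessThan_iff)
  \<comment> \<open>As a total function \<open>\<phi>\<close> has an arbitrary value at
    \<open>T\<close>; the limit \<open>L\<close> has to be put there explicitly.\<close>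
  define \<phi>1 where "\<phi>1 t = (if t < T then \<phi> t else L)" for t
  have \<phi>1c: "continuous_on {a..T} \<phi>1"
    unfolding continuous_on_def
  proof
    fix t assume t: "t \<in> {a..T}"
    show "(\<phi>1 \<longlongrightarrow> \<phi>1 t) (at t within {a..T})"
    proof (cases "t < T")
      case True
      have "(\<phi> \<longlongrightarrow> \<phi> t) (at t within {a..<T})"
        using DERIV_continuous_on[OF \<phi>] t True by (auto simp: continuous_on_def)
      moreover have "at t within {a..<T} = at t within {a..T}"
        using True by (intro at_within_nhd[where S = "{..<T}"]) auto
      ultimately have "(\<phi> \<longlongrightarrow> \<phi>1 t) (at t within {a..T})"
        using True by (simp add: \<phi>1_def)
      moreover have "\<forall>\<^sub>F s in at t within {a..T}. \<phi> s = \<phi>1 s"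
        using eventually_at_topological True
        by (auto simp: eventually_at_topological \<phi>1_def intro!: exI[of _ "{..<T}"])
      ultimately show ?thesis
        by (rule Lim_transform_eventually)
    next
      case False
      then have "t = T" using t by simp
      have "at T within {a..T} = at_left T"
        using \<open>a < T\<close> by (rule at_within_Icc_at_left)
      moreover have "\<forall>\<^sub>F s in at_left T. \<phi> s = \<phi>1 s"
        by (auto simp: eventually_at_filter \<phi>1_def)
      ultimately show ?thesis
        using lim \<open>t = T\<close> by (auto simp: \<phi>1_def intro: Lim_transform_eventually)
    qed
  qed
  have coeff: "continuous_on {a..T} (\<lambda>t. f t (\<phi>1 t))"
    if "continuous_on ({a..} \<times> UNIV) (\<lambda>(t, w). f t w)" for f :: "real \<Rightarrow> real \<Rightarrow> real"
    using that \<phi>1c by (rule continuous_on_along_graph) auto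
  have hc: "continuous_on {a..T} (\<lambda>t. q t (\<phi>1 t) / p t (\<phi>1 t))"
    using p_pos by (intro continuous_intros coeff p q) (auto simp: less_imp_neq[symmetric])
  have kc: "continuous_on {a..T} (\<lambda>t. r t (\<phi>1 t) * \<phi>1 t)"
    by (intro continuous_intros coeff r \<phi>1c)
  have u1: "(u has_real_derivative - (q t (\<phi>1 t) / p t (\<phi>1 t) * u t) - r t (\<phi>1 t) * \<phi>1 t)
      (at t within {a..<T})" if "t \<in> {a..<T}" for t
    using u[OF that] that by (simp add: \<phi>1_def)
  \<comment> \<open>With the coefficients frozen along \<open>\<phi>1\<close>, the equation for
    \<open>u\<close> is linear and has continuous coefficients up to \<open>T\<close>.\<close>
  obtain v where vc: "continuous_on {a..T} v" and v: "\<And>t. t \<in> {a..<T} \<Longrightarrow> v t = u t"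
    using linear_ode_extends_to_endpoint[OF hc kc u1] by blast
  \<comment> \<open>The vector field of the system, with \<open>z\<close> standing for the pair of
    \<open>\<phi>\<close> and \<open>u\<close>.\<close>
  define F where "F t z = (snd z / p t (fst z), - (q t (fst z) / p t (fst z) * snd z) - r t (fst z) * fst z)"
    for t and z :: "real \<times> real"
  have lift: "continuous_on ({a..} \<times> UNIV) (\<lambda>x. f (fst x) (fst (snd x)))"
    if "continuous_on ({a..} \<times> UNIV) (\<lambda>(t, w). f t w)" for f :: "real \<Rightarrow> real \<Rightarrow> real"
  proof -
    have "continuous_on ({a..} \<times> UNIV) (\<lambda>x. (\<lambda>(t, w). f t w) (fst x, fst (snd x)))"
      by (intro continuous_on_compose2[OF that] continuous_intros) auto
    then show ?thesis by simp
  qed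
  have Fc: "continuous_on ({a..} \<times> UNIV) (\<lambda>(t, z). F t z)"
    unfolding F_def split_beta using p_pos
    by (intro continuous_intros lift p q r) (auto simp: less_imp_neq[symmetric])
  \<comment> \<open>The length 1 and the radius 1 are arbitrary, as \<open>F\<close> is continuous
    for all times from \<open>a\<close> on and all states.\<close>
  have "continuous_on ({T..T + 1} \<times> cball (\<phi>1 T, v T) 1) (\<lambda>(t, z). F t z)"
    using \<open>a < T\<close> by (intro continuous_on_subset[OF Fc]) auto
  then obtain c y where "T < c" "y T = (\<phi>1 T, v T)"
    and y: "\<And>t. t \<in> {T..c} \<Longrightarrow> (y has_vector_derivative F t (y t)) (at t within {T..c})"
    by (rule peano) auto
  \<comment> \<open>Both branches agree at \<open>T\<close> by the choice of the initial value of
    \<open>y\<close>, so the glued curve is continuous.\<close>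
  define z where "z t = (if t \<le> T then (\<phi>1 t, v t) else y t)" for t
  have zc: "continuous_on {a..c} z"
    unfolding z_def
  proof (rule continuous_on_cases_le)
    have "{t \<in> {a..c}. t \<le> T} \<subseteq> {a..T}" by auto
    then show "continuous_on {t \<in> {a..c}. t \<le> T} (\<lambda>t. (\<phi>1 t, v t))"
      by (rule continuous_on_subset[rotated]) (intro continuous_intros \<phi>1c vc)
    have "continuous_on {T..c} y"
      using y by (rule continuous_on_vector_derivative)
    then show "continuous_on {t \<in> {a..c}. T \<le> t} y"
      by (rule continuous_on_subset) auto
  qed (use \<open>y T = (\<phi>1 T, v T)\<close> in auto)
  have z: "(z has_vector_derivative F t (z t)) (at t within {a..c})" if "t \<in> {a..c}" for t
  \<comment> \<open>The two pieces give only one-sided information at \<open>T\<close>; continuity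
    of \<open>F\<close> along \<open>z\<close> supplies the derivative there.\<close>
  proof (rule has_vector_derivative_except_finite[where S = "{T}", OF zc _ _ _ that])
    show "continuous_on {a..c} (\<lambda>t. F t (z t))"
      using Fc zc by (rule continuous_on_along_graph) auto
    fix t assume t: "t \<in> {a<..<c} - {T}"
    show "(z has_vector_derivative F t (z t)) (at t)"
    proof (cases "t < T")
      case True
      then have t': "t \<in> {a..<T}" and at: "at t within {a..<T} = at t"
        using t by (auto intro: at_within_interior)
      have "((\<lambda>t. (\<phi> t, u t)) has_vector_derivative F t (z t)) (at t)"
        using has_vector_derivative_Pair[OF
            \<phi>[OF t', unfolded has_real_derivative_iff_has_vector_derivative]
            u[OF t', unfolded has_real_derivative_iff_has_vector_derivative]]
        True v[OF t'] by (simp add: F_def z_def \<phi>1_def at)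
      then show ?thesis
      proof (rule has_vector_derivative_transform_within_open)
        show "open {a<..<T}" "t \<in> {a<..<T}"
          using t True by auto
        show "(\<phi> s, u s) = z s" if "s \<in> {a<..<T}" for s
          using that v[of s] by (simp add: z_def \<phi>1_def)
      qed
    next
      case False
      then have "(y has_vector_derivative F t (z t)) (at t)"
        using y[of t] t at_within_Icc_at[of T t c] by (simp add: z_def)
      then show ?thesis
      proof (rule has_vector_derivative_transform_within_open)
        show "open {T<..<c}" "t \<in> {T<..<c}"
          using t False by auto
        show "y s = z s" if "s \<in> {T<..<c}" for s
          using that by (simp add: z_def)
      qed
    qed
  qed simp
  have "solution_on p q r {a..<c} (\<lambda>t. fst (z t))"
  proof (rule system_imp_solution_on)
    have "continuous_on {a..<c} (\<lambda>t. f t (fst (z t)))"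
      if "continuous_on ({a..} \<times> UNIV) (\<lambda>(t, w). f t w)" for f :: "real \<Rightarrow> real \<Rightarrow> real"
      using that by (rule continuous_on_along_graph)
        (auto intro!: continuous_intros continuous_on_subset[OF zc])
    then show "continuous_on {a..<c} (\<lambda>t. p t (fst (z t)))" "continuous_on {a..<c} (\<lambda>t. q t (fst (z t)))"
      "continuous_on {a..<c} (\<lambda>t. r t (fst (z t)))"
      using p q r by blast+
    fix t assume t: "t \<in> {a..<c}"
    show "p t (fst (z t)) > 0"
      using t p_pos by simp
    have zt: "(z has_vector_derivative F t (z t)) (at t within {a..<c})"
      using t by (intro has_vector_derivative_within_subset[OF z]) auto
    show "((\<lambda>t. fst (z t)) has_real_derivative snd (z t) / p t (fst (z t))) (at t within {a..<c})"
      using bounded_linear.has_vector_derivative[OF bounded_linear_fst zt]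
      by (simp add: has_real_derivative_iff_has_vector_derivative F_def)
    show "((\<lambda>t. snd (z t)) has_real_derivative
        - (q t (fst (z t)) / p t (fst (z t)) * snd (z t)) - r t (fst (z t)) * fst (z t)) (at t within {a..<c})"
      using bounded_linear.has_vector_derivative[OF bounded_linear_snd zt]
      by (simp add: has_real_derivative_iff_has_vector_derivative F_def)
  qed
  then show thesis
    by (rule that[OF \<open>T < c\<close>]) (simp add: z_def \<phi>1_def)
qed

section \<open>Sign changes\<close>

text \<open>Both signs occur arbitrarily late, so an alternating chain can always be prolonged by a
  later point of the opposite sign.\<close>

lemma changes_sign_infinitely_oftenI:
  fixes \<phi> :: "real \<Rightarrow> real"
  assumes "a < T" and "\<And>s. s \<in> {a..<T} \<Longrightarrow> \<exists>t\<in>{s..<T}. 0 < \<phi> t" "\<And>s. s \<in> {a..<T} \<Longrightarrow> \<exists>t\<in>{s..<T}. \<phi> t < 0"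
  shows "changes_sign_infinitely_often_on {a..<T} \<phi>"
  unfolding changes_sign_infinitely_often_on_def
proof
  \<comment> \<open>The added claim \<open>\<phi> (s n) \<noteq> 0\<close> gives the last point a
    sign to oppose, also for \<open>n = 0\<close>, where there are no products.\<close>
  have "\<exists>s. strict_mono_on {..n} s \<and> s ` {..n} \<subseteq> {a..<T} \<and>
      (\<forall>i<n. \<phi> (s i) * \<phi> (s (Suc i)) < 0) \<and> \<phi> (s n) \<noteq> 0" for n :: nat
  proof (induction n)
    case 0
    obtain t where "t \<in> {a..<T}" "0 < \<phi> t"
      using assms(1) assms(2)[of a] by auto
    then show ?case
      by (intro exI[of _ "\<lambda>_. t"]) (auto simp: strict_mono_on_def)
  next
    case (Suc n)
    then obtain s where s: "strict_mono_on {..n} s" "s ` {..n} \<subseteq> {a..<T}"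
      "\<forall>i<n. \<phi> (s i) * \<phi> (s (Suc i)) < 0" "\<phi> (s n) \<noteq> 0"
      by blast
    have sn: "s n \<in> {a..<T}"
      using s(2) by auto
    obtain t where t: "t \<in> {s n..<T}" "\<phi> (s n) * \<phi> t < 0"
      using assms(2,3)[OF sn] s(4) by (cases "\<phi> (s n) < 0") (force simp: mult_less_0_iff)+
    \<comment> \<open>If \<open>t = s n\<close>, the product would be a square and could not be
      negative.\<close>
    have "s n < t"
      using t by (cases "t = s n") (auto simp: mult_less_0_iff)
    define s' where "s' = s(Suc n := t)"
    have "s' i < s' j" if "i < j" "j \<le> Suc n" for i j
    proof (cases "j = Suc n")
      case True
      have "s i \<le> s n"
        using that True strict_mono_onD[OF s(1), of i n] by (cases "i = n") auto
      then show ?thesis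
        using \<open>s n < t\<close> True that by (simp add: s'_def)
    next
      case False
      then show ?thesis
        using that strict_mono_onD[OF s(1), of i j] by (simp add: s'_def)
    qed
    then have "strict_mono_on {..Suc n} s'"
      by (auto simp: strict_mono_on_def)
    moreover have "s' ` {..Suc n} \<subseteq> {a..<T}"
      using s(2) sn t(1) by (auto simp: s'_def image_subset_iff intro: order_trans)
    moreover have "\<forall>i<Suc n. \<phi> (s' i) * \<phi> (s' (Suc i)) < 0"
      using s(3) t(2) by (auto simp: s'_def less_Suc_eq)
    moreover have "\<phi> (s' (Suc n)) \<noteq> 0"
      using t(2) by (auto simp: s'_def)
    ultimately show ?case by blast
  qed
  then show "\<exists>s. strict_mono_on {..n} s \<and> s ` {..n} \<subseteq> {a..<T} \<and> (\<forall>i<n. \<phi> (s i) * \<phi> (s (Suc i)) < 0)"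
    for n :: nat
    by blast
qed

section \<open>Oscillation of non-extendable solutions\<close>

theorem theorem3p4:
  fixes t0 :: real
    and p0 q0 r0 :: "real \<Rightarrow> real \<Rightarrow> real"
    and P Q :: "real \<Rightarrow> real"
    and c0 c1 T :: real
    and \<phi>0 :: "real \<Rightarrow> real"
  assumes "continuous_on ({t0..} \<times> UNIV) (\<lambda>(t, w). p0 t w)"
    and "continuous_on ({t0..} \<times> UNIV) (\<lambda>(t, w). q0 t w)"
    and "continuous_on ({t0..} \<times> UNIV) (\<lambda>(t, w). r0 t w)"
    and "\<And>t w. t0 \<le> t \<Longrightarrow> p0 t w > 0"
    and "continuous_on {t0..} P"
    and "continuous_on {t0..} Q"
    and "\<And>t. t0 \<le> t \<Longrightarrow> P t > 0"
    and "\<And>t w. t0 \<le> t \<Longrightarrow> p0 t w \<ge> P t"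
    and "\<And>t w. t0 \<le> t \<Longrightarrow> q0 t w / p0 t w \<ge> Q t"
    and "\<And>t w. t0 \<le> t \<Longrightarrow> r0 t w \<ge> 0"
    and "maximal_existence_interval p0 q0 r0 t0 T \<phi>0"
    and "\<phi>0 t0 = c0"
    and "(\<phi>0 has_real_derivative c1) (at t0 within {t0..<T})"
  shows "singular_oscillatory_second_kind {t0..<T} \<phi>0"
proof -
  note pqr = assms(1-4) and r_nonneg = assms(10)
  have "t0 < T" and sol: "solution_on p0 q0 r0 {t0..<T} \<phi>0"
    and maximal: "\<not> (\<exists>T' \<psi>. T < T' \<and> solution_on p0 q0 r0 {t0..<T'} \<psi> \<and> (\<forall>t\<in>{t0..<T}. \<psi> t = \<phi>0 t))"
    using assms(11) unfolding maximal_existence_interval_def by auto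
  \<comment> \<open>By maximality it now suffices to derive a finite limit at \<open>T\<close> from
    constant sign near \<open>T\<close>.\<close>
  have no_limit: "\<not> (\<phi>0 \<longlongrightarrow> L) (at_left T)" for L
    using solution_continues_past_limit[OF pqr \<open>t0 < T\<close> sol] maximal by metis
  \<comment> \<open>\<open>P\<close> and \<open>Q\<close> are continuous up to and including
    \<open>T\<close>, so their minima on the compact interval give bounds uniform in
    \<open>t\<close> and \<open>w\<close>.\<close>
  have "continuous_on {t0..T} P"
    using assms(5) by (rule continuous_on_subset) auto
  then obtain tP where "tP \<in> {t0..T}" "\<And>t. t \<in> {t0..T} \<Longrightarrow> P tP \<le> P t"
    using continuous_attains_inf[of "{t0..T}" P] \<open>t0 < T\<close> by auto
  then have "P tP > 0" and p_ge: "\<And>t w. t \<in> {t0..<T} \<Longrightarrow> P tP \<le> p0 t w"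
    using assms(7)[of tP] order_trans[OF _ assms(8)] by auto
  have "continuous_on {t0..T} Q"
    using assms(6) by (rule continuous_on_subset) auto
  then obtain tQ where tQ: "\<forall>t\<in>{t0..T}. Q tQ \<le> Q t"
    using continuous_attains_inf[of "{t0..T}" Q] \<open>t0 < T\<close> by auto
  \<comment> \<open>The minimum of \<open>Q\<close> may have either sign, while the bound
    \<open>B\<close> of \<open>nonneg_solution_has_limit\<close> must be nonnegative.\<close>
  have qp_ge: "- \<bar>Q tQ\<bar> \<le> q0 t w / p0 t w" if "t \<in> {t0..<T}" for t w
    using bspec[OF tQ, of t] assms(9)[of t w] that by auto
  obtain u where
    \<phi>: "\<And>t. t \<in> {t0..<T} \<Longrightarrow> (\<phi>0 has_real_derivative u t / p0 t (\<phi>0 t)) (at t within {t0..<T})"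
    and u: "\<And>t. t \<in> {t0..<T} \<Longrightarrow> (u has_real_derivative
          - (q0 t (\<phi>0 t) / p0 t (\<phi>0 t) * u t) - r0 t (\<phi>0 t) * \<phi>0 t) (at t within {t0..<T})"
    using solution_on_imp_system[OF sol] assms(4) by (metis atLeastLessThan_iff)
  have \<phi>c: "continuous_on {t0..<T} \<phi>0"
    using \<phi> by (rule DERIV_continuous_on)
  have coeff: "continuous_on {t0..<T} (\<lambda>t. f t (\<phi>0 t))"
    if "continuous_on ({t0..} \<times> UNIV) (\<lambda>(t, w). f t w)" for f :: "real \<Rightarrow> real \<Rightarrow> real"
    using that \<phi>c by (rule continuous_on_along_graph) auto
  have hc: "continuous_on {t0..<T} (\<lambda>t. q0 t (\<phi>0 t) / p0 t (\<phi>0 t))"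
    using assms(4) by (intro continuous_intros coeff assms(1,2)) (auto simp: less_imp_neq[symmetric])
  text \<open>The system solved by \<open>(\<phi>0, u)\<close> is linear once its coefficients are frozen along \<open>\<phi>0\<close>,
    so its solutions may be negated.\<close>
  have not_one_signed: "\<exists>t\<in>{s..<T}. \<sigma> * \<phi>0 t < 0" if s: "s \<in> {t0..<T}" and \<sigma>: "\<sigma> \<in> {1, -1}" for s \<sigma>
  proof (rule ccontr)
    assume "\<not> ?thesis"
    then have nonneg: "0 \<le> \<sigma> * \<phi>0 t" if "t \<in> {s..<T}" for t
      using that by (meson not_less)
    have sub: "{s..<T} \<subseteq> {t0..<T}" using s by auto
    obtain L where "((\<lambda>t. \<sigma> * \<phi>0 t) \<longlongrightarrow> L) (at_left T)"
    proof (rule nonneg_solution_has_limit[where a = s and T = T and \<phi> = "\<lambda>t. \<sigma> * \<phi>0 t" and u = "\<lambda>t. \<sigma> * u t"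
          and p = "\<lambda>t. p0 t (\<phi>0 t)" and h = "\<lambda>t. q0 t (\<phi>0 t) / p0 t (\<phi>0 t)" and r = "\<lambda>t. r0 t (\<phi>0 t)"
          and m = "P tP" and B = "\<bar>Q tQ\<bar>"])
      show "s < T" using s by simp
      show "continuous_on {s..<T} (\<lambda>t. q0 t (\<phi>0 t) / p0 t (\<phi>0 t))"
        using hc sub by (rule continuous_on_subset)
      show "0 < P tP" by fact
      fix t assume t: "t \<in> {s..<T}"
      then have t': "t \<in> {t0..<T}" using sub by auto
      show "P tP \<le> p0 t (\<phi>0 t)" using p_ge[OF t'] .
      show "- \<bar>Q tQ\<bar> \<le> q0 t (\<phi>0 t) / p0 t (\<phi>0 t)" using qp_ge[OF t'] .
      show "0 \<le> r0 t (\<phi>0 t)" using r_nonneg t' by simp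
      show "0 \<le> \<sigma> * \<phi>0 t" using nonneg[OF t] .
      show "((\<lambda>t. \<sigma> * \<phi>0 t) has_real_derivative \<sigma> * u t / p0 t (\<phi>0 t)) (at t within {s..<T})"
        using DERIV_cmult[OF has_field_derivative_subset[OF \<phi>[OF t'] sub], of \<sigma>] by simp
      show "((\<lambda>t. \<sigma> * u t) has_real_derivative - (q0 t (\<phi>0 t) / p0 t (\<phi>0 t) * (\<sigma> * u t))
          - r0 t (\<phi>0 t) * (\<sigma> * \<phi>0 t)) (at t within {s..<T})"
        using DERIV_cmult[OF has_field_derivative_subset[OF u[OF t'] sub], of \<sigma>]
        by (simp add: algebra_simps)
    qed auto
    \<comment> \<open>Since \<open>\<sigma> * \<sigma> = 1\<close>, multiplying by
      \<open>\<sigma>\<close> again recovers a limit of \<open>\<phi>0\<close> itself.\<close>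
    then have "((\<lambda>t. \<sigma> * (\<sigma> * \<phi>0 t)) \<longlongrightarrow> \<sigma> * L) (at_left T)"
      by (intro tendsto_intros)
    then show False
      using no_limit[of "\<sigma> * L"] \<sigma> by auto
  qed
  \<comment> \<open>The sign \<open>-1\<close> yields late points with \<open>\<phi>0\<close>
    positive, the sign 1 late points with \<open>\<phi>0\<close> negative.\<close>
  have "changes_sign_infinitely_often_on {t0..<T} \<phi>0"
    using \<open>t0 < T\<close> not_one_signed[of _ "-1"] not_one_signed[of _ 1]
    by (intro changes_sign_infinitely_oftenI) auto
  then show ?thesis
    unfolding singular_oscillatory_second_kind_def by simp
qed

end
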